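(* Let $n\ge 1$, let $\theta_1,\dots,\theta_n>0$ be pairwise distinct, and let $S_n\sim\mathrm{HypoXG}(\theta_1,\dots,\theta_n)$. Then, for $t>0$, the hazard function of $S_n$ satisfies $$h_{S_n}(t)=\frac{\sum_{i=1}^{n}\sum_{k=1}^{3}R_{ik}\,h_{Y_{ik}}(t)\,R_{Y_{ik}}(t)}{\sum_{i=1}^{n}\sum_{k=1}^{3}R_{ik}\,R_{Y_{ik}}(t)},$$ where $h_{Y_{ik}}$ and $R_{Y_{ik}}$ are the hazard function and the reliability function of $Y_{ik}\sim\mathrm{Erl}(4-k,\theta_i)$, and the $R_{ik}$ are the HypoXG coefficients associated with $(\theta_1,\dots,\theta_n)$.
   Context: For a random variable $X$ with cumulative distribution function $F_X$ and density $f_X$ (taken continuous on $(0,\infty)$), the reliability function is $R_X(t)=1-F_X(t)$ (not to be confused with the real coefficients $R_{ik}$) and the hazard function is $h_X(t)=f_X(t)/R_X(t)$. XGamma distribution: for $\theta>0$, $X\sim \mathrm{XG}(\theta)$ means $X$ is a real random variable with density $\frac{\theta^2}{1+\theta}\left(1+\frac{\theta}{2}t^2\right)e^{-\theta t}$ for $t>0$, and $0$ otherwise. HypoXG: $S_n\sim\mathrm{HypoXG}(\theta_1,\dots,\theta_n)$ means $S_n=X_1+\cdots+X_n$ with $X_1,\dots,X_n$ independent and $X_j\sim\mathrm{XG}(\theta_j)$. Erlang distribution: for an integer $m\ge 1$ and $\theta>0$, $Y\sim\mathrm{Erl}(m,\theta)$ means $Y$ has density $\frac{(\theta t)^{m-1}\theta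 e^{-\theta t}}{(m-1)!}$ for $t\ge 0$ and $0$ for $t<0$. HypoXG coefficients: for pairwise distinct $\theta_1,\dots,\theta_n>0$, $1\le i\le n$, $1\le k\le 3$, $$R_{ik}=\frac{A_{ik}}{\theta_i^{4-k}}\prod_{l=1}^{n}\frac{\theta_l^{2}}{1+\theta_l},$$ where $$A_{i1}=\theta_i\prod_{j\ne i}\frac{(\theta_j-\theta_i)^2+\theta_j}{(\theta_j-\theta_i)^3},\qquad A_{i2}=A_{i1}\sum_{j\neq i}\left(\frac{2(\theta_j-\theta_i)}{(\theta_j-\theta_i)^2+\theta_j}-\frac{3}{\theta_j-\theta_i}\right),$$ $$A_{i3}=\frac{A_{i1}}{2}\left(\sum_{j\ne i}\left(\frac{2(\theta_j-\theta_i)}{(\theta_j-\theta_i)^2+\theta_j}-\frac{3}{\theta_j-\theta_i}\right)\right)^{2}+\frac{A_{i1}}{2}\left(\frac{2}{\theta_i}+\sum_{j\ne i}\left(-2\,\frac{(\theta_j-\theta_i)^2-\theta_j}{\left((\theta_j-\theta_i)^2+\theta_j\right)^2}+\frac{3}{(\theta_j-\theta_i)^2}\right)\right),$$ products and sums being over $j\in\{1,\dots,n\}\setminus\{i\}$ (empty product $=1$, empty sum $=0$). *)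

theory Defs
  imports "HOL-Probability.Probability"
begin

definition reliability :: "'a measure \<Rightarrow> ('a \<Rightarrow> real) \<Rightarrow> real \<Rightarrow> real" where
  "reliability M X t = 1 - cdf (distr M borel X) t"

definition is_cont_density :: "'a measure \<Rightarrow> ('a \<Rightarrow> real) \<Rightarrow> (real \<Rightarrow> real) \<Rightarrow> bool" where
  "is_cont_density M X f \<longleftrightarrow>
     (\<forall>t. 0 \<le> f t) \<and> distributed M lborel X (\<lambda>t. ennreal (f t)) \<and> continuous_on {0<..} f"

text \<open>
  The density of a random variable is determined only almost everywhere. Continuity
  on the open half-line fixes its values there, whatever function is chosen; see
  \<open>cont_density_eq\<close> below. Values at arguments \<open>t \<le> 0\<close> are not meaningful.
\<close>

definition cont_density :: "'a measure \<Rightarrow> ('a \<Rightarrow> real) \<Rightarrow> real \<Rightarrow> real" where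
  "cont_density M X = (SOME f. is_cont_density M X f)"

definition hazard :: "'a measure \<Rightarrow> ('a \<Rightarrow> real) \<Rightarrow> real \<Rightarrow> real" where
  "hazard M X t = cont_density M X t / reliability M X t"

lemma is_cont_density_unique:
  assumes "prob_space M" "is_cont_density M X f" "is_cont_density M X g" "0 < t"
  shows "f t = g t"
proof -
  have "AE x in lborel. ennreal (f x) = ennreal (g x)"
    using assms(2,3) by (intro prob_space.distributed_unique[OF assms(1)])
      (auto simp: is_cont_density_def)
  then have "AE x in lborel. f x - g x = 0"
    using assms(2,3) by (auto simp: is_cont_density_def)
  then have "AE x in lebesgue. f x - g x = 0"
    by (rule AE_completion)
  then have ae: "AE x \<in> {t/2<..<2*t} in lebesgue. x \<in> {x \<in> {t/2..2*t}. f x - g x = 0}"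
    by eventually_elim auto
  have "continuous_on {t/2..2*t} (\<lambda>x. f x - g x)"
    using assms(2-4) by (intro continuous_on_diff)
      (auto simp: is_cont_density_def elim!: continuous_on_subset)
  then have "closed {x \<in> {t/2..2*t}. f x - g x = 0}"
    by (intro continuous_closed_preimage_constant) auto
  from mem_closed_if_AE_lebesgue_open[OF _ this ae, of t] show ?thesis
    using \<open>0 < t\<close> by auto
qed

lemma cont_density_eq:
  assumes "prob_space M" "is_cont_density M X f" "0 < t"
  shows "cont_density M X t = f t"
  using is_cont_density_unique[OF assms(1) _ assms(2,3)] someI[of "is_cont_density M X", OF assms(2)]
  unfolding cont_density_def by blast

definition xgamma_density :: "real \<Rightarrow> real \<Rightarrow> real" where
  "xgamma_density \<theta> t =
     (if 0 < t then \<theta>\<^sup>2 / (1 + \<theta>) * (1 + \<theta> / 2 * t\<^sup>2) * exp (- \<theta> * t) else 0)"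

definition XG :: "'a measure \<Rightarrow> ('a \<Rightarrow> real) \<Rightarrow> real \<Rightarrow> bool" where
  "XG M X \<theta> \<longleftrightarrow> distributed M lborel X (\<lambda>t. ennreal (xgamma_density \<theta> t))"

definition HypoXG :: "'a measure \<Rightarrow> ('a \<Rightarrow> real) \<Rightarrow> nat \<Rightarrow> (nat \<Rightarrow> real) \<Rightarrow> bool" where
  "HypoXG M S n \<theta> \<longleftrightarrow>
     (\<exists>X. prob_space.indep_vars M (\<lambda>_. borel) X {1..n} \<and>
          (\<forall>j\<in>{1..n}. XG M (X j) (\<theta> j)) \<and>
          (\<forall>\<omega>\<in>space M. S \<omega> = (\<Sum>j=1..n. X j \<omega>)))"

text \<open>
  The first parameter of \<^const>\<open>erlang_density\<close> is one less than the number of stages.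
  Only \<open>m \<ge> 1\<close> is meaningful here.
\<close>

definition Erl :: "'a measure \<Rightarrow> ('a \<Rightarrow> real) \<Rightarrow> nat \<Rightarrow> real \<Rightarrow> bool" where
  "Erl M Y m \<theta> \<longleftrightarrow> distributed M lborel Y (\<lambda>t. ennreal (erlang_density (m - 1) \<theta> t))"

definition hypoxg_A1 :: "nat \<Rightarrow> (nat \<Rightarrow> real) \<Rightarrow> nat \<Rightarrow> real" where
  "hypoxg_A1 n \<theta> i =
     \<theta> i * (\<Prod>j\<in>{1..n} - {i}. ((\<theta> j - \<theta> i)\<^sup>2 + \<theta> j) / (\<theta> j - \<theta> i) ^ 3)"

definition hypoxg_A2 :: "nat \<Rightarrow> (nat \<Rightarrow> real) \<Rightarrow> nat \<Rightarrow> real" where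
  "hypoxg_A2 n \<theta> i =
     hypoxg_A1 n \<theta> i *
       (\<Sum>j\<in>{1..n} - {i}. 2 * (\<theta> j - \<theta> i) / ((\<theta> j - \<theta> i)\<^sup>2 + \<theta> j) - 3 / (\<theta> j - \<theta> i))"

definition hypoxg_A3 :: "nat \<Rightarrow> (nat \<Rightarrow> real) \<Rightarrow> nat \<Rightarrow> real" where
  "hypoxg_A3 n \<theta> i =
     hypoxg_A1 n \<theta> i / 2 *
       (\<Sum>j\<in>{1..n} - {i}. 2 * (\<theta> j - \<theta> i) / ((\<theta> j - \<theta> i)\<^sup>2 + \<theta> j) - 3 / (\<theta> j - \<theta> i))\<^sup>2
     + hypoxg_A1 n \<theta> i / 2 *
       (2 / \<theta> i +
        (\<Sum>j\<in>{1..n} - {i}.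
           - 2 * (((\<theta> j - \<theta> i)\<^sup>2 - \<theta> j) / ((\<theta> j - \<theta> i)\<^sup>2 + \<theta> j)\<^sup>2) + 3 / (\<theta> j - \<theta> i)\<^sup>2))"

definition hypoxg_A :: "nat \<Rightarrow> (nat \<Rightarrow> real) \<Rightarrow> nat \<Rightarrow> nat \<Rightarrow> real" where
  "hypoxg_A n \<theta> i k =
     (if k = 1 then hypoxg_A1 n \<theta> i else if k = 2 then hypoxg_A2 n \<theta> i else hypoxg_A3 n \<theta> i)"

definition hypoxg_R :: "nat \<Rightarrow> (nat \<Rightarrow> real) \<Rightarrow> nat \<Rightarrow> nat \<Rightarrow> real" where
  "hypoxg_R n \<theta> i k =
     hypoxg_A n \<theta> i k / \<theta> i ^ (4 - k) * (\<Prod>l=1..n. (\<theta> l)\<^sup>2 / (1 + \<theta> l))"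

end

theory Submission
  imports Defs "HOL-Computational_Algebra.Polynomial_FPS"
begin

text \<open>
  Convolving \<open>x ^ k * exp (- a x)\<close> and \<open>x ^ m * exp (- b x)\<close> with \<open>a \<noteq> b\<close> gives a linear combination
  of functions of the same two shapes, so by induction the density of \<open>S\<close> is a combination of
  \<open>t ^ k * exp (- \<theta> i * t)\<close> with \<open>k < 3\<close> and unknown coefficients. Its Laplace transform is the
  product of the transforms of the summands, and comparing the principal parts at the poles
  \<open>- \<theta> i\<close> identifies the coefficients: the density of \<open>S\<close> is the signed mixture of Erlang
  densities with weights \<open>R i k\<close>. Integrating over the tail gives the same mixture for the
  reliability, and \<open>h * R\<close> is the density for each Erlang variable.
\<close>

unbundle no vec_syntax
unbundle fps_syntax

section \<open>Exponential polynomials and their convolution\<close>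

definition pexp :: "real \<Rightarrow> nat \<Rightarrow> real \<Rightarrow> real" where
  "pexp a k t = t ^ k / fact k * exp (- a * t)"

text \<open>The coefficients stay existential because convolution only has to preserve the shape;
  their values come later from Laplace transforms. The bound 3 is the order of the poles of an
  XGamma transform. Requiring equality at every real \<open>t\<close> lets measurability be read off
  from the representation.\<close>

definition exp_comb :: "'i set \<Rightarrow> ('i \<Rightarrow> real) \<Rightarrow> (real \<Rightarrow> real) \<Rightarrow> bool" where
  "exp_comb I \<theta> f \<longleftrightarrow> (\<exists>C. \<forall>t. f t = (\<Sum>i\<in>I. \<Sum>k<3. C i k * pexp (\<theta> i) k t))"

lemma exp_comb_add:
  assumes "exp_comb I \<theta> f" "exp_comb I \<theta> g"
  shows "exp_comb I \<theta> (\<lambda>t. f t + g t)"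
proof -
  obtain C D where "\<forall>t. f t = (\<Sum>i\<in>I. \<Sum>k<3. C i k * pexp (\<theta> i) k t)"
    and "\<forall>t. g t = (\<Sum>i\<in>I. \<Sum>k<3. D i k * pexp (\<theta> i) k t)"
    using assms unfolding exp_comb_def by blast
  then show ?thesis
    unfolding exp_comb_def
    by (intro exI[of _ "\<lambda>i k. C i k + D i k"]) (simp add: sum.distrib algebra_simps)
qed

lemma exp_comb_cmult:
  assumes "exp_comb I \<theta> f"
  shows "exp_comb I \<theta> (\<lambda>t. c * f t)"
proof -
  obtain C where "\<forall>t. f t = (\<Sum>i\<in>I. \<Sum>k<3. C i k * pexp (\<theta> i) k t)"
    using assms unfolding exp_comb_def by blast
  then show ?thesis
    unfolding exp_comb_def
    by (intro exI[of _ "\<lambda>i k. c * C i k"]) (simp add: sum_distrib_left mult.assoc)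
qed

lemma exp_comb_zero: "exp_comb I \<theta> (\<lambda>t. 0)"
  unfolding exp_comb_def by (intro exI[of _ "\<lambda>i k. 0"]) simp

lemma exp_comb_diff:
  "exp_comb I \<theta> f \<Longrightarrow> exp_comb I \<theta> g \<Longrightarrow> exp_comb I \<theta> (\<lambda>t. f t - g t)"
  using exp_comb_add[of I \<theta> f "\<lambda>t. - 1 * g t"] exp_comb_cmult[of I \<theta> g "- 1"] by simp

lemma exp_comb_sum:
  assumes "finite A" "\<And>x. x \<in> A \<Longrightarrow> exp_comb I \<theta> (f x)"
  shows "exp_comb I \<theta> (\<lambda>t. \<Sum>x\<in>A. f x t)"
  using assms by (induction rule: finite_induct) (auto intro: exp_comb_add exp_comb_zero)

lemma exp_comb_pexp:
  assumes "finite I" "i \<in> I" "k < 3"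
  shows "exp_comb I \<theta> (pexp (\<theta> i) k)"
  unfolding exp_comb_def
proof (intro exI[of _ "\<lambda>j m. if j = i then if m = k then 1 else 0 else 0"] allI)
  fix t
  have "(\<Sum>j\<in>I. \<Sum>m<3. (if j = i then if m = k then 1 else 0 else 0) * pexp (\<theta> j) m t)
      = (\<Sum>j\<in>I. if j = i then \<Sum>m<3. if m = k then pexp (\<theta> i) m t else 0 else 0)"
    by (intro sum.cong refl) (simp add: if_distrib[of "\<lambda>c. c * _"] cong: if_cong)
  also have "\<dots> = pexp (\<theta> i) k t"
    using assms by simp
  finally show "pexp (\<theta> i) k t
      = (\<Sum>j\<in>I. \<Sum>m<3. (if j = i then if m = k then 1 else 0 else 0) * pexp (\<theta> j) m t)" ..
qed

lemma pexp_nonneg: "0 \<le> t \<Longrightarrow> 0 \<le> pexp a k t"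
  by (simp add: pexp_def)

lemma continuous_on_pexp [continuous_intros]: "continuous_on A (pexp a k)"
  unfolding pexp_def by (intro continuous_intros) auto

lemma borel_measurable_pexp [measurable]: "pexp a k \<in> borel_measurable borel"
  unfolding pexp_def by measurable

text \<open>Dividing by \<open>fact k\<close> absorbs the factor from the power rule, so
  differentiation lowers the index without a numerical coefficient. The same normalisation makes the
  Laplace transform a pure inverse power.\<close>

lemma has_real_derivative_pexp:
  "(pexp a k has_real_derivative (if k = 0 then 0 else pexp a (k - 1) t) - a * pexp a k t) (at t)"
proof (cases k)
  case 0
  then show ?thesis
    unfolding pexp_def by (auto intro!: derivative_eq_intros)
next
  case (Suc m)
  have "((\<lambda>t. t ^ Suc m / fact (Suc m) * exp (- a * t)) has_real_derivative
      real (Suc m) * t ^ m / fact (Suc m) * exp (- a * t)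
      - a * (t ^ Suc m / fact (Suc m) * exp (- a * t))) (at t)"
    by (auto intro!: derivative_eq_intros simp: field_simps simp del: fact_Suc power_Suc)
  moreover have "real (Suc m) * t ^ m / fact (Suc m) = t ^ m / fact m"
    by (simp only: fact_Suc) (simp del: of_nat_Suc)
  ultimately show ?thesis
    unfolding Suc pexp_def[abs_def] by simp
qed

text \<open>Integrating the derivative of \<open>x \<mapsto> pexp a k x * pexp b m (t - x)\<close> over \<open>[0, t]\<close> gives a
  recursion for the convolution in which the factor \<open>b - a\<close> has to be divided out.\<close>

lemma convolution_pexp:
  assumes I: "finite I" "i \<in> I" "j \<in> I" and ne: "\<theta> i \<noteq> \<theta> j" and "k < 3" "m < 3"
  shows "\<exists>F. exp_comb I \<theta> F \<and>
    (\<forall>t\<ge>0. ((\<lambda>x. pexp (\<theta> i) k x * pexp (\<theta> j) m (t - x)) has_integral F t) {0..t})"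
  using \<open>k < 3\<close> \<open>m < 3\<close>
\<comment> \<open>The product rule yields the wanted product and two terms in which one of the
  indices is lowered by one, so the sum of the indices is the measure.\<close>
proof (induction "k + m" arbitrary: k m rule: less_induct)
  case less
  let ?a = "\<theta> i" and ?b = "\<theta> j"
  \<comment> \<open>With index 0 there is no lowered term and the zero function serves; otherwise
    the induction hypothesis applies.\<close>
  have "\<exists>F. exp_comb I \<theta> F \<and> (\<forall>t\<ge>0. ((\<lambda>x. (if k = 0 then 0 else pexp ?a (k - 1) x) * pexp ?b m (t - x))
      has_integral F t) {0..t})"
  proof (cases k)
    case 0
    then show ?thesis
      by (intro exI[of _ "\<lambda>_. 0"]) (simp add: exp_comb_zero)
  next
    case (Suc k')
    then show ?thesis
      using less(1)[of k' m] less(2,3) by simp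
  qed
  then obtain F1 where F1: "exp_comb I \<theta> F1"
    "\<And>t. 0 \<le> t \<Longrightarrow> ((\<lambda>x. (if k = 0 then 0 else pexp ?a (k - 1) x) * pexp ?b m (t - x)) has_integral F1 t) {0..t}"
    by blast
  have "\<exists>F. exp_comb I \<theta> F \<and> (\<forall>t\<ge>0. ((\<lambda>x. pexp ?a k x * (if m = 0 then 0 else pexp ?b (m - 1) (t - x)))
      has_integral F t) {0..t})"
  proof (cases m)
    case 0
    then show ?thesis
      by (intro exI[of _ "\<lambda>_. 0"]) (simp add: exp_comb_zero)
  next
    case (Suc m')
    then show ?thesis
      using less(1)[of k m'] less(2,3) by simp
  qed
  then obtain F2 where F2: "exp_comb I \<theta> F2"
    "\<And>t. 0 \<le> t \<Longrightarrow> ((\<lambda>x. pexp ?a k x * (if m = 0 then 0 else pexp ?b (m - 1) (t - x))) has_integral F2 t) {0..t}"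
    by blast
  \<comment> \<open>Obtained by solving (boundary terms) =
    \<open>F1 t - F2 t + (?b - ?a) * F t\<close>. The values at 0 are constants, 1 or 0 according to
    the index, so \<open>F\<close> stays in the span.\<close>
  define F where "F t = 1 / (?b - ?a) *
    (pexp ?b m 0 * pexp ?a k t - pexp ?a k 0 * pexp ?b m t - F1 t + F2 t)" for t
  have "exp_comb I \<theta> F"
    unfolding F_def using F1(1) F2(1) I less(2,3)
    by (intro exp_comb_cmult exp_comb_add exp_comb_diff exp_comb_pexp)
  moreover have "((\<lambda>x. pexp ?a k x * pexp ?b m (t - x)) has_integral F t) {0..t}" if "0 \<le> t" for t
  proof -
    let ?A = "\<lambda>x. if k = 0 then 0 else pexp ?a (k - 1) x"
    let ?B = "\<lambda>x. if m = 0 then 0 else pexp ?b (m - 1) (t - x)"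
    have d: "((\<lambda>x. pexp ?a k x * pexp ?b m (t - x)) has_real_derivative
        ?A x * pexp ?b m (t - x) - pexp ?a k x * ?B x
        + (?b - ?a) * (pexp ?a k x * pexp ?b m (t - x))) (at x)" for x
    proof -
      have "((\<lambda>x. t - x) has_real_derivative - 1) (at x)"
        by (auto intro!: derivative_eq_intros)
      from DERIV_chain2[OF has_real_derivative_pexp this]
      show ?thesis
        by (rule DERIV_cong[OF DERIV_mult[OF has_real_derivative_pexp]])
          (simp add: algebra_simps)
    qed
    have "((\<lambda>x. ?A x * pexp ?b m (t - x) - pexp ?a k x * ?B x
        + (?b - ?a) * (pexp ?a k x * pexp ?b m (t - x))) has_integral
        pexp ?a k t * pexp ?b m (t - t) - pexp ?a k 0 * pexp ?b m (t - 0)) {0..t}"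
      using \<open>0 \<le> t\<close> d
      by (intro fundamental_theorem_of_calculus)
        (auto simp: has_real_derivative_iff_has_vector_derivative intro: has_vector_derivative_at_within)
    from has_integral_add[OF has_integral_diff[OF this F1(2)[OF \<open>0 \<le> t\<close>]] F2(2)[OF \<open>0 \<le> t\<close>]]
    have "((\<lambda>x. (?b - ?a) * (pexp ?a k x * pexp ?b m (t - x))) has_integral
        pexp ?b m 0 * pexp ?a k t - pexp ?a k 0 * pexp ?b m t - F1 t + F2 t) {0..t}"
      by (simp add: mult.commute)
    from has_integral_mult_right[OF this, of "1 / (?b - ?a)"] ne
    show ?thesis
      unfolding F_def by simp
  qed
  ultimately show ?case
    by blast
qed

section \<open>The density of a sum of independent XGamma variables\<close>

lemma xgamma_density_eq:
  "xgamma_density \<theta> t =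
    (if 0 < t then \<theta>\<^sup>2 / (1 + \<theta>) * pexp \<theta> 0 t + \<theta>\<^sup>2 / (1 + \<theta>) * \<theta> * pexp \<theta> 2 t else 0)"
  by (simp add: xgamma_density_def pexp_def algebra_simps power2_eq_square)

lemma xgamma_density_nonneg: "0 < \<theta> \<Longrightarrow> 0 \<le> xgamma_density \<theta> t"
  by (simp add: xgamma_density_def)

lemma borel_measurable_xgamma_density [measurable]: "xgamma_density \<theta> \<in> borel_measurable borel"
  unfolding xgamma_density_def by measurable

lemma borel_measurable_exp_comb:
  assumes "exp_comb I \<theta> f"
  shows "f \<in> borel_measurable borel"
proof -
  obtain C where "\<forall>t. f t = (\<Sum>i\<in>I. \<Sum>k<3. C i k * pexp (\<theta> i) k t)"
    using assms unfolding exp_comb_def by blast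
  then have "f = (\<lambda>t. \<Sum>i\<in>I. \<Sum>k<3. C i k * pexp (\<theta> i) k t)"
    by auto
  then show ?thesis
    by simp
qed

text \<open>Bilinearity reduces this to \<open>convolution_pexp\<close>. Injectivity makes the new
  exponent differ from all old ones; a coincidence could push the power of the variable beyond 2 and
  out of the span.\<close>

lemma convolution_exp_comb_xgamma:
  assumes I: "finite I" "j \<notin> I" "inj_on \<theta> (insert j I)" and f: "exp_comb I \<theta> f"
  shows "\<exists>F. exp_comb (insert j I) \<theta> F \<and>
    (\<forall>t\<ge>0. ((\<lambda>x. f x * xgamma_density (\<theta> j) (t - x)) has_integral F t) {0<..<t})"
proof -
  let ?b = "\<theta> j"
  define w where "w = ?b\<^sup>2 / (1 + ?b)"
  obtain C where C: "\<And>t. f t = (\<Sum>i\<in>I. \<Sum>k<3. C i k * pexp (\<theta> i) k t)"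
    using f unfolding exp_comb_def by blast
  let ?P = "\<lambda>i k m F. exp_comb (insert j I) \<theta> F \<and>
    (\<forall>t\<ge>0. ((\<lambda>x. pexp (\<theta> i) k x * pexp ?b m (t - x)) has_integral F t) {0..t})"
  have ex: "\<exists>F. ?P i k m F" if "i \<in> I" "k < 3" "m < 3" for i k m
  proof -
    have "\<theta> i \<noteq> ?b"
      using inj_onD[OF I(3), of i j] that I by auto
    then show ?thesis
      using that I by (intro convolution_pexp) auto
  qed
  define F where "F i k m = (SOME F. ?P i k m F)" for i k m
  have F: "?P i k m (F i k m)" if "i \<in> I" "k < 3" "m < 3" for i k m
    using someI_ex[OF ex[OF that]] unfolding F_def .
  define G where "G t = (\<Sum>i\<in>I. \<Sum>k<3. C i k * (w * F i k 0 t + w * ?b * F i k 2 t))" for t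
  have "exp_comb (insert j I) \<theta> G"
    unfolding G_def using I F
    by (intro exp_comb_sum exp_comb_cmult exp_comb_add) auto
  moreover have "((\<lambda>x. f x * xgamma_density ?b (t - x)) has_integral G t) {0<..<t}" if "0 \<le> t" for t
  proof -
    have "((\<lambda>x. \<Sum>i\<in>I. \<Sum>k<3. C i k * (w * (pexp (\<theta> i) k x * pexp ?b 0 (t - x))
        + w * ?b * (pexp (\<theta> i) k x * pexp ?b 2 (t - x)))) has_integral G t) {0..t}"
      unfolding G_def using I F \<open>0 \<le> t\<close>
      by (intro has_integral_sum has_integral_mult_right has_integral_add) auto
    \<comment> \<open>The endpoints are null. At \<open>x = t\<close> the density is 0 by definition
      while its formula gives \<open>w\<close>, so the pointwise replacement is made on the open
      interval.\<close>
    then have "((\<lambda>x. \<Sum>i\<in>I. \<Sum>k<3. C i k * (w * (pexp (\<theta> i) k x * pexp ?b 0 (t - x))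
        + w * ?b * (pexp (\<theta> i) k x * pexp ?b 2 (t - x)))) has_integral G t) {0<..<t}"
      by (simp only: has_integral_Icc_iff_Ioo)
    then show ?thesis
    proof (rule has_integral_eq[rotated])
      fix x assume "x \<in> {0<..<t}"
      then have g: "xgamma_density ?b (t - x) = w * pexp ?b 0 (t - x) + w * ?b * pexp ?b 2 (t - x)"
        by (simp add: xgamma_density_eq w_def)
      show "(\<Sum>i\<in>I. \<Sum>k<3. C i k * (w * (pexp (\<theta> i) k x * pexp ?b 0 (t - x))
          + w * ?b * (pexp (\<theta> i) k x * pexp ?b 2 (t - x)))) = f x * xgamma_density ?b (t - x)"
        unfolding g C sum_distrib_right by (intro sum.cong refl) (simp add: algebra_simps)
    qed
  qed
  ultimately show ?thesis
    by blast
qed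

text \<open>Induction on the index set, convolving with one more density each time. Nonnegativity is
  carried along since the coefficients may have either sign; it passes to the next stage because the
  convolution integrates a nonnegative function.\<close>

lemma (in prob_space) distributed_sum_XG:
  assumes "finite I" "I \<noteq> {}" "indep_vars (\<lambda>_. borel) X I" "inj_on \<theta> I"
    "\<And>j. j \<in> I \<Longrightarrow> 0 < \<theta> j" "\<And>j. j \<in> I \<Longrightarrow> XG M (X j) (\<theta> j)"
  shows "\<exists>f. exp_comb I \<theta> f \<and> (\<forall>t>0. 0 \<le> f t) \<and>
    distributed M lborel (\<lambda>\<omega>. \<Sum>j\<in>I. X j \<omega>) (\<lambda>t. ennreal (if 0 < t then f t else 0))"
  using assms
proof (induction rule: finite_ne_induct)
  case (singleton j)
  let ?w = "(\<theta> j)\<^sup>2 / (1 + \<theta> j)"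
  define f where "f t = ?w * pexp (\<theta> j) 0 t + ?w * \<theta> j * pexp (\<theta> j) 2 t" for t
  have eq: "xgamma_density (\<theta> j) t = (if 0 < t then f t else 0)" for t
    by (simp add: xgamma_density_eq f_def)
  have "exp_comb {j} \<theta> f"
    unfolding f_def by (intro exp_comb_add exp_comb_cmult exp_comb_pexp) auto
  moreover have "\<forall>t>0. 0 \<le> f t"
    using singleton.prems(3)[of j] by (simp add: f_def pexp_nonneg)
  moreover have "distributed M lborel (\<lambda>\<omega>. \<Sum>j\<in>{j}. X j \<omega>) (\<lambda>t. ennreal (if 0 < t then f t else 0))"
    using singleton.prems(4)[of j] unfolding XG_def by (simp add: eq)
  ultimately show ?case
    by blast
next
  case (insert j I)
  let ?g = "xgamma_density (\<theta> j)"
  have "indep_vars (\<lambda>_. borel) X I"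
    using insert.prems(1) by (rule indep_vars_subset) auto
  then obtain f where f: "exp_comb I \<theta> f" "\<And>t. 0 < t \<Longrightarrow> 0 \<le> f t"
    "distributed M lborel (\<lambda>\<omega>. \<Sum>j\<in>I. X j \<omega>) (\<lambda>t. ennreal (if 0 < t then f t else 0))"
    using insert.IH insert.prems by (auto simp: inj_on_insert)
  obtain F where F: "exp_comb (insert j I) \<theta> F"
    "\<And>t. 0 \<le> t \<Longrightarrow> ((\<lambda>x. f x * ?g (t - x)) has_integral F t) {0<..<t}"
    using convolution_exp_comb_xgamma[OF insert.hyps(1,3) insert.prems(2) f(1)] by blast
  have g0: "0 \<le> ?g t" for t
    using insert.prems(3)[of j] by (simp add: xgamma_density_nonneg)
  have F0: "0 \<le> F t" if "0 < t" for t
    using F(2)[of t] that f(2) g0 by (intro has_integral_nonneg[OF F(2)]) auto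
  note [measurable] = borel_measurable_exp_comb[OF f(1)]
  have conv: "(\<integral>\<^sup>+y. ennreal (?g (t - y)) * ennreal (if 0 < y then f y else 0) \<partial>lborel)
      = ennreal (if 0 < t then F t else 0)" for t
  proof -
    \<comment> \<open>Both densities vanish at nonpositive arguments, so the integrand lives on the
      interval from 0 to \<open>t\<close>, which is empty for \<open>t \<le> 0\<close>.\<close>
    let ?h = "\<lambda>x. if x \<in> {0<..<t} then f x * ?g (t - x) else 0"
    have "(\<integral>\<^sup>+y. ennreal (?g (t - y)) * ennreal (if 0 < y then f y else 0) \<partial>lborel)
        = (\<integral>\<^sup>+y. ennreal (?h y) \<partial>lborel)"
      using g0 f(2)
      by (intro nn_integral_cong)
        (auto simp: ennreal_mult'[symmetric] mult.commute xgamma_density_def)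
    also have "\<dots> = ennreal (if 0 < t then F t else 0)"
    proof (cases "0 < t")
      case True
      have "(?h has_integral F t) UNIV"
        using F(2)[of t] True by (simp only: has_integral_restrict_UNIV)
      then have "(\<integral>\<^sup>+y. ennreal (?h y) \<partial>lborel) = ennreal (F t)"
        using g0 f(2) by (intro nn_integral_has_integral_lborel) auto
      then show ?thesis
        using True by simp
    next
      case False
      then have "?h y = 0" for y
        by auto
      with False show ?thesis
        by simp
    qed
    finally show ?thesis .
  qed
  have "distributed M lborel (\<lambda>\<omega>. X j \<omega> + (\<Sum>j\<in>I. X j \<omega>))
      (\<lambda>t. \<integral>\<^sup>+y. ennreal (?g (t - y)) * ennreal (if 0 < y then f y else 0) \<partial>lborel)"
    using insert.prems(4)[of j] insert.hyps insert.prems(1) f(3) unfolding XG_def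
    by (intro distributed_convolution indep_vars_sum) auto
  then have "distributed M lborel (\<lambda>\<omega>. \<Sum>j\<in>insert j I. X j \<omega>) (\<lambda>t. ennreal (if 0 < t then F t else 0))"
    using insert.hyps by (simp add: conv)
  with F(1) F0 show ?case
    by blast
qed

section \<open>Laplace transforms\<close>

lemma erlang_density_eq_pexp:
  "0 \<le> t \<Longrightarrow> erlang_density k a t = a ^ Suc k * pexp a k t"
  by (simp add: erlang_density_def pexp_def)

lemma has_bochner_integral_erlang_density:
  assumes "0 < a"
  shows "has_bochner_integral lborel (erlang_density k a) 1"
  \<comment> \<open>The total mass is the moment of order 0.\<close>
  using nn_integral_erlang_ith_moment[OF assms, of k 0] assms
  by (intro has_bochner_integral_nn_integral) auto

text \<open>The damping factor turns rate \<open>a\<close> into rate \<open>a + s\<close>: on the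
  positive half-line the integrand is a multiple of an Erlang density of that rate, whose mass is
  1.\<close>

lemma has_bochner_integral_pexp_laplace:
  assumes "0 < a + s"
  shows "has_bochner_integral lborel (\<lambda>t. (if 0 < t then pexp a k t else 0) * exp (- s * t))
    (1 / (a + s) ^ Suc k)"
proof -
  have "has_bochner_integral lborel (\<lambda>t. 1 / (a + s) ^ Suc k * erlang_density k (a + s) t)
      (1 / (a + s) ^ Suc k * 1)"
    using has_bochner_integral_erlang_density[OF assms]
    by (intro has_bochner_integral_mult_right) auto
  moreover have "AE t in lborel. 1 / (a + s) ^ Suc k * erlang_density k (a + s) t
      = (if 0 < t then pexp a k t else 0) * exp (- s * t)"
    \<comment> \<open>For \<open>k = 0\<close> the two sides differ at 0, where the Erlang density
      is positive and the cut-off function is 0.\<close>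
    using AE_lborel_singleton[of 0]
  proof eventually_elim
    case (elim t)
    have "exp (- (a + s) * t) = exp (- a * t) * exp (- s * t)"
      by (simp add: exp_add[symmetric] algebra_simps)
    then show ?case
      using elim assms
      by (cases "0 < t") (simp_all add: erlang_density_def pexp_def)
  qed
  ultimately show ?thesis
    by (subst has_bochner_integral_cong_AE[symmetric]) auto
qed

lemma has_bochner_integral_xgamma_laplace:
  assumes "0 < \<theta>" "0 \<le> s"
  shows "has_bochner_integral lborel (\<lambda>t. xgamma_density \<theta> t * exp (- s * t))
    (\<theta>\<^sup>2 / (1 + \<theta>) * (((s + \<theta>)\<^sup>2 + \<theta>) / (s + \<theta>) ^ 3))"
proof -
  let ?w = "\<theta>\<^sup>2 / (1 + \<theta>)"
  have "has_bochner_integral lborel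
      (\<lambda>t. ?w * ((if 0 < t then pexp \<theta> 0 t else 0) * exp (- s * t))
         + ?w * \<theta> * ((if 0 < t then pexp \<theta> 2 t else 0) * exp (- s * t)))
      (?w * (1 / (\<theta> + s) ^ Suc 0) + ?w * \<theta> * (1 / (\<theta> + s) ^ Suc 2))"
    using assms
    by (intro has_bochner_integral_add has_bochner_integral_mult_right has_bochner_integral_pexp_laplace) auto
  moreover have "?w * (1 / (\<theta> + s) ^ Suc 0) + ?w * \<theta> * (1 / (\<theta> + s) ^ Suc 2)
      = ?w * (((s + \<theta>)\<^sup>2 + \<theta>) / (s + \<theta>) ^ 3)"
  proof -
    have "1 / (\<theta> + s) = (s + \<theta>)\<^sup>2 / (s + \<theta>) ^ 3"
      using assms by (simp add: power2_eq_square power3_eq_cube add.commute)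
    then show ?thesis
      by (simp add: add.commute distrib_left add_divide_distrib eval_nat_numeral)
  qed
  moreover have "(\<lambda>t. ?w * ((if 0 < t then pexp \<theta> 0 t else 0) * exp (- s * t))
         + ?w * \<theta> * ((if 0 < t then pexp \<theta> 2 t else 0) * exp (- s * t)))
      = (\<lambda>t. xgamma_density \<theta> t * exp (- s * t))"
    by (auto simp: xgamma_density_eq algebra_simps)
  ultimately show ?thesis
    by (simp only:)
qed

text \<open>Independence turns the expectation of the product into a product of expectations. This
  evaluation does not use the density of the sum, so equating it with the transform of that density
  determines the unknown coefficients.\<close>

lemma (in prob_space) laplace_sum_XG:
  assumes "finite I" "indep_vars (\<lambda>_. borel) X I"
    and \<theta>: "\<And>j. j \<in> I \<Longrightarrow> 0 < \<theta> j" and X: "\<And>j. j \<in> I \<Longrightarrow> XG M (X j) (\<theta> j)" and "0 \<le> s"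
  shows "(\<integral>\<omega>. exp (- s * (\<Sum>j\<in>I. X j \<omega>)) \<partial>M)
    = (\<Prod>j\<in>I. (\<theta> j)\<^sup>2 / (1 + \<theta> j)) * (\<Prod>j\<in>I. ((s + \<theta> j)\<^sup>2 + \<theta> j) / (s + \<theta> j) ^ 3)"
proof -
  let ?v = "\<lambda>j. (\<theta> j)\<^sup>2 / (1 + \<theta> j) * (((s + \<theta> j)\<^sup>2 + \<theta> j) / (s + \<theta> j) ^ 3)"
  have X': "distributed M lborel (X j) (\<lambda>t. ennreal (xgamma_density (\<theta> j) t))" if "j \<in> I" for j
    using X[OF that] by (simp add: XG_def)
  have int: "integrable M (\<lambda>\<omega>. exp (- s * X j \<omega>))" if "j \<in> I" for j
    using distributed_integrable[OF X'[OF that], of "\<lambda>t. exp (- s * t)"]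
      has_bochner_integral_xgamma_laplace[OF \<theta>[OF that] \<open>0 \<le> s\<close>] \<theta>[OF that]
    by (auto simp: has_bochner_integral_iff xgamma_density_nonneg)
  have val: "(\<integral>\<omega>. exp (- s * X j \<omega>) \<partial>M) = ?v j" if "j \<in> I" for j
    using distributed_integral[OF X'[OF that], of "\<lambda>t. exp (- s * t)"]
      has_bochner_integral_xgamma_laplace[OF \<theta>[OF that] \<open>0 \<le> s\<close>] \<theta>[OF that]
    by (auto simp: has_bochner_integral_iff xgamma_density_nonneg)
  have "(\<integral>\<omega>. exp (- s * (\<Sum>j\<in>I. X j \<omega>)) \<partial>M) = (\<integral>\<omega>. (\<Prod>j\<in>I. exp (- s * X j \<omega>)) \<partial>M)"
    using \<open>finite I\<close> by (simp add: sum_distrib_left exp_sum sum_negf[symmetric] del: sum_negf)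
  also have "\<dots> = (\<Prod>j\<in>I. \<integral>\<omega>. exp (- s * X j \<omega>) \<partial>M)"
    using assms(1) int indep_vars_compose2[OF assms(2), of "\<lambda>_ x. exp (- s * x)" "\<lambda>_. borel"]
    by (intro indep_vars_lebesgue_integral) auto
  also have "\<dots> = (\<Prod>j\<in>I. ?v j)"
    using val by (intro prod.cong) auto
  finally show ?thesis
    by (simp only: prod.distrib)
qed

section \<open>Second-order power series and partial fractions\<close>

lemma fps_mult_nth_2: "(f * g) $ 2 = f $ 0 * g $ 2 + f $ 1 * g $ 1 + f $ 2 * g $ 0"
  for f g :: "'a :: comm_ring_1 fps"
  by (simp add: fps_mult_nth eval_nat_numeral)

text \<open>Here \<open>r\<close> and \<open>w\<close> play the role of the first two derivatives at \<open>0\<close> of the logarithm of a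
  factor, which turn the product into sums.\<close>

lemma fps_prod_second_order:
  fixes f :: "'i \<Rightarrow> real fps"
  assumes "finite I" "\<And>j. j \<in> I \<Longrightarrow> f j $ 0 = a j" "\<And>j. j \<in> I \<Longrightarrow> f j $ 1 = a j * r j"
    "\<And>j. j \<in> I \<Longrightarrow> f j $ 2 = a j * ((r j)\<^sup>2 + w j) / 2"
  shows "prod f I $ 0 = prod a I \<and> prod f I $ 1 = prod a I * sum r I \<and>
    prod f I $ 2 = prod a I * ((sum r I)\<^sup>2 + sum w I) / 2"
  using assms
proof (induction rule: finite_induct)
  case empty
  then show ?case by simp
next
  case (insert j I)
  then have IH: "prod f I $ 0 = prod a I" "prod f I $ 1 = prod a I * sum r I"
    "prod f I $ 2 = prod a I * ((sum r I)\<^sup>2 + sum w I) / 2"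
    by auto
  have fj: "f j $ 0 = a j" "f j $ 1 = a j * r j" "f j $ 2 = a j * ((r j)\<^sup>2 + w j) / 2"
    using insert.prems by auto
  show ?case
    unfolding prod.insert[OF insert.hyps] sum.insert[OF insert.hyps]
      fps_mult_nth_0 fps_mult_nth_1 fps_mult_nth_2 IH fj
    by (simp add: field_simps power2_eq_square)
qed

text \<open>Here \<open>f\<close> expands \<open>((d + u)\<^sup>2 + b) / (d + u) ^ 3\<close> in
  powers of \<open>u\<close>. Its coefficients are found one after another from
  \<open>f * ?L = ?Q\<close>, in the shape that \<open>fps_prod_second_order\<close>
  expects.\<close>

lemma fps_hypoxg_factor:
  fixes d b :: real
  assumes "d \<noteq> 0" "0 < b"
  defines "q \<equiv> d\<^sup>2 + b"
  defines "f \<equiv> fps_of_poly ([:d, 1:]\<^sup>2 + [:b:]) * inverse (fps_of_poly ([:d, 1:] ^ 3))"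
  shows "f $ 0 = q / d ^ 3" "f $ 1 = q / d ^ 3 * (2 * d / q - 3 / d)"
    "f $ 2 = q / d ^ 3 * ((2 * d / q - 3 / d)\<^sup>2 + (- 2 * ((d\<^sup>2 - b) / q\<^sup>2) + 3 / d\<^sup>2)) / 2"
proof -
  let ?L = "fps_of_poly ([:d, 1:] ^ 3)" and ?Q = "fps_of_poly ([:d, 1:]\<^sup>2 + [:b:])"
  have L: "?L $ 0 = d ^ 3" "?L $ 1 = 3 * d\<^sup>2" "?L $ 2 = 3 * d"
    by (simp_all add: eval_nat_numeral algebra_simps)
  have Q: "?Q $ 0 = q" "?Q $ 1 = 2 * d" "?Q $ 2 = 1"
    by (simp_all add: eval_nat_numeral algebra_simps q_def)
  have "q > 0"
    unfolding q_def using assms(2) by (simp add: add_nonneg_pos)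
  have "f * ?L = ?Q"
    unfolding f_def using L(1) \<open>d \<noteq> 0\<close> by (simp add: mult.assoc inverse_mult_eq_1)
  then have c: "(f * ?L) $ k = ?Q $ k" for k
    by simp
  note c = c[of 0, unfolded fps_mult_nth_0 L Q] c[of 1, unfolded fps_mult_nth_1 L Q]
    c[of 2, unfolded fps_mult_nth_2 L Q]
  show 0: "f $ 0 = q / d ^ 3"
    using c(1) \<open>d \<noteq> 0\<close> by (simp add: field_simps)
  have "q / d ^ 3 * (2 * d / q - 3 / d) * d ^ 3 = 2 * d - q / d ^ 3 * (3 * d\<^sup>2)"
    using \<open>d \<noteq> 0\<close> \<open>q > 0\<close> by (simp add: field_simps eval_nat_numeral)
  also have "\<dots> = f $ 1 * d ^ 3"
    using c(2) unfolding 0 by (simp add: algebra_simps)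
  finally show 1: "f $ 1 = q / d ^ 3 * (2 * d / q - 3 / d)"
    using \<open>d \<noteq> 0\<close> by simp
  have "q / d ^ 3 * ((2 * d / q - 3 / d)\<^sup>2 + (- 2 * ((d\<^sup>2 - b) / q\<^sup>2) + 3 / d\<^sup>2)) / 2 * d ^ 3
      = 1 - q / d ^ 3 * (3 * d) - q / d ^ 3 * (2 * d / q - 3 / d) * (3 * d\<^sup>2)"
  proof -
    \<comment> \<open>Eliminating \<open>b\<close> keeps the denominator \<open>q\<close> atomic, so
      that clearing fractions leaves a polynomial identity in \<open>d\<close> and
      \<open>q\<close>.\<close>
    have b: "b = q - d\<^sup>2"
      by (simp add: q_def)
    show ?thesis
      unfolding b using \<open>d \<noteq> 0\<close> \<open>q > 0\<close> by (simp add: field_simps eval_nat_numeral)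
  qed
  also have "\<dots> = f $ 2 * d ^ 3"
    using c(3) unfolding 0 1 by linarith
  finally show "f $ 2 = q / d ^ 3 * ((2 * d / q - 3 / d)\<^sup>2 + (- 2 * ((d\<^sup>2 - b) / q\<^sup>2) + 3 / d\<^sup>2)) / 2"
    using \<open>d \<noteq> 0\<close> by simp
qed

text \<open>Needed because the two transforms are compared only for
  \<open>0 \<le> s\<close>.\<close>

lemma poly_eqI_halfline:
  fixes p q :: "real poly"
  assumes "\<And>x. c \<le> x \<Longrightarrow> poly p x = poly q x"
  shows "p = q"
proof (rule ccontr)
  assume "p \<noteq> q"
  then have "finite {x. poly (p - q) x = 0}"
    by (intro poly_roots_finite) simp
  moreover have "{c..} \<subseteq> {x. poly (p - q) x = 0}"
    using assms by auto
  ultimately show False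
    using infinite_Ici finite_subset by blast
qed

text \<open>Clearing denominators in the variable \<open>u = s + \<theta> i\<close> gives a polynomial identity. Modulo
  \<open>u ^ 3\<close> only the terms with pole \<open>- \<theta> i\<close> survive on the left, and the remaining denominators are
  units in the ring of power series.\<close>

lemma partial_fraction_coefficients:
  fixes C :: "'i \<Rightarrow> nat \<Rightarrow> real"
  assumes "finite I" "i \<in> I" "inj_on \<theta> I" and pos: "\<And>j. j \<in> I \<Longrightarrow> 0 < \<theta> j"
    and eq: "\<And>s. 0 \<le> s \<Longrightarrow> (\<Sum>j\<in>I. \<Sum>k<3. C j k / (s + \<theta> j) ^ Suc k)
      = W * (\<Prod>j\<in>I. ((s + \<theta> j)\<^sup>2 + \<theta> j) / (s + \<theta> j) ^ 3)"
  defines "d \<equiv> \<lambda>j. \<theta> j - \<theta> i"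
  defines "P \<equiv> \<Prod>j\<in>I-{i}. ((d j)\<^sup>2 + \<theta> j) / d j ^ 3"
  defines "r \<equiv> \<Sum>j\<in>I-{i}. 2 * d j / ((d j)\<^sup>2 + \<theta> j) - 3 / d j"
  defines "w \<equiv> \<Sum>j\<in>I-{i}. - 2 * (((d j)\<^sup>2 - \<theta> j) / ((d j)\<^sup>2 + \<theta> j)\<^sup>2) + 3 / (d j)\<^sup>2"
  shows "C i 2 = W * (\<theta> i * P)" "C i 1 = W * (\<theta> i * P * r)"
    "C i 0 = W * (P + \<theta> i * P * (r\<^sup>2 + w) / 2)"
proof -
  let ?L = "\<lambda>j. [:d j, 1:]" and ?J = "I - {i}"
  let ?Q = "\<lambda>j. ?L j ^ 2 + [:\<theta> j:]"
  have dne: "d j \<noteq> 0" if "j \<in> ?J" for j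
    using that assms(2,3) by (auto simp: d_def dest: inj_onD)
  \<comment> \<open>With \<open>u\<close> the indeterminate, \<open>D\<close> is the common
    denominator of the poles other than \<open>- \<theta> i\<close>, \<open>B\<close> the numerator
    of their terms over \<open>D\<close>, and \<open>A\<close> is \<open>u ^ 3\<close> times the
    principal part at \<open>- \<theta> i\<close>.\<close>
  define B where "B = (\<Sum>j\<in>?J. \<Sum>k<3. smult (C j k) (?L j ^ (2 - k) * (\<Prod>l\<in>?J-{j}. ?L l ^ 3)))"
  define D where "D = (\<Prod>l\<in>?J. ?L l ^ 3)"
  define A where "A = (\<Sum>k<3. smult (C i k) ([:0, 1:] ^ (2 - k)))"
  have poly_id: "A * D + [:0, 1:] ^ 3 * B = smult W (?Q i * (\<Prod>j\<in>?J. ?Q j))"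
  \<comment> \<open>The bound \<open>\<theta> i \<le> u\<close> is \<open>0 \<le> s\<close> for
    \<open>s = u - \<theta> i\<close>. The identity is the hypothesis multiplied by all the
    cubes.\<close>
  proof (rule poly_eqI_halfline[of "\<theta> i"])
    fix u assume u: "\<theta> i \<le> u"
    have L0: "d j + u > 0" if "j \<in> I" for j
      using pos[OF that] u by (simp add: d_def)
    let ?N = "\<lambda>A. \<Prod>l\<in>A. (d l + u) ^ 3"
    have "(\<Prod>j\<in>I. ((d j + u)\<^sup>2 + \<theta> j) / (d j + u) ^ 3) * ?N I = (\<Prod>j\<in>I. ((d j + u)\<^sup>2 + \<theta> j))"
      unfolding prod.distrib[symmetric]
    proof (intro prod.cong refl)
      fix j assume "j \<in> I"
      then show "((d j + u)\<^sup>2 + \<theta> j) / (d j + u) ^ 3 * (d j + u) ^ 3 = (d j + u)\<^sup>2 + \<theta> j"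
        using L0[of j] by simp
    qed
    moreover have "(\<Sum>j\<in>I. \<Sum>k<3. C j k / (d j + u) ^ Suc k)
        = W * (\<Prod>j\<in>I. ((d j + u)\<^sup>2 + \<theta> j) / (d j + u) ^ 3)"
      using eq[of "u - \<theta> i"] u by (simp add: d_def algebra_simps)
    ultimately have "(\<Sum>j\<in>I. \<Sum>k<3. C j k / (d j + u) ^ Suc k) * ?N I
        = W * (\<Prod>j\<in>I. ((d j + u)\<^sup>2 + \<theta> j))"
      by (simp only: mult.assoc)
    moreover have "(\<Sum>j\<in>I. \<Sum>k<3. C j k / (d j + u) ^ Suc k) * ?N I
        = (\<Sum>j\<in>I. \<Sum>k<3. C j k * (d j + u) ^ (2 - k) * ?N (I - {j}))"
      unfolding sum_distrib_right
    proof (intro sum.cong refl)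
      fix j and k :: nat assume j: "j \<in> I" and "k \<in> {..<3}"
      then have "3 = Suc k + (2 - k)"
        by auto
      then have "(d j + u) ^ 3 = (d j + u) ^ Suc k * (d j + u) ^ (2 - k)"
        by (metis power_add)
      moreover have "?N I = (d j + u) ^ 3 * ?N (I - {j})"
        using \<open>finite I\<close> j by (rule prod.remove)
      ultimately show "C j k / (d j + u) ^ Suc k * ?N I = C j k * (d j + u) ^ (2 - k) * ?N (I - {j})"
        using L0[OF j] by simp
    qed
    moreover have "\<dots> = (\<Sum>k<3. C i k * (d i + u) ^ (2 - k) * ?N ?J)
        + (\<Sum>j\<in>?J. \<Sum>k<3. C j k * (d j + u) ^ (2 - k) * ?N (I - {j}))"
      using \<open>finite I\<close> \<open>i \<in> I\<close> by (rule sum.remove)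
    moreover have "(\<Sum>k<3. C i k * (d i + u) ^ (2 - k) * ?N ?J) = poly (A * D) u"
      by (simp add: A_def D_def poly_sum poly_prod sum_distrib_right d_def mult.assoc)
    moreover have "(\<Sum>j\<in>?J. \<Sum>k<3. C j k * (d j + u) ^ (2 - k) * ?N (I - {j}))
        = poly ([:0, 1:] ^ 3 * B) u"
    proof -
      have N: "?N (I - {j}) = u ^ 3 * ?N (?J - {j})" if "j \<in> ?J" for j
      proof -
        have "?N (I - {j}) = (d i + u) ^ 3 * ?N (I - {j} - {i})"
          using that \<open>finite I\<close> \<open>i \<in> I\<close> by (intro prod.remove) auto
        then show ?thesis
          by (simp add: d_def Diff_insert2[symmetric] insert_commute)
      qed
      show ?thesis
        unfolding B_def poly_mult poly_sum sum_distrib_left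
        by (intro sum.cong refl) (simp add: N poly_prod mult_ac)
    qed
    moreover have "(\<Prod>j\<in>I. ((d j + u)\<^sup>2 + \<theta> j)) = ((d i + u)\<^sup>2 + \<theta> i) * (\<Prod>j\<in>?J. ((d j + u)\<^sup>2 + \<theta> j))"
      using \<open>finite I\<close> \<open>i \<in> I\<close> by (rule prod.remove)
    ultimately show "poly (A * D + [:0, 1:] ^ 3 * B) u = poly (smult W (?Q i * (\<Prod>j\<in>?J. ?Q j))) u"
      by (simp add: poly_prod)
  qed
  let ?f = "\<lambda>j. fps_of_poly (?Q j) * inverse (fps_of_poly (?L j ^ 3))"
  define g where "g = (\<Prod>j\<in>?J. ?f j)"
  have "g $ 0 = P \<and> g $ 1 = P * r \<and> g $ 2 = P * (r\<^sup>2 + w) / 2"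
    unfolding g_def P_def r_def w_def
    using \<open>finite I\<close>
    by (intro fps_prod_second_order fps_hypoxg_factor) (auto simp: dne intro: pos)
  note g = this[THEN conjunct1] this[THEN conjunct2, THEN conjunct1] this[THEN conjunct2, THEN conjunct2]
  \<comment> \<open>Distinctness of the parameters enters here: it makes \<open>D\<close> a unit
    among power series.\<close>
  have D0: "fps_of_poly D $ 0 \<noteq> 0"
    using dne \<open>finite I\<close> by (simp add: D_def poly_0_coeff_0[symmetric] poly_prod)
  have gD: "g * fps_of_poly D = fps_of_poly (\<Prod>j\<in>?J. ?Q j)"
    unfolding g_def D_def fps_of_poly_prod prod.distrib[symmetric]
  proof (intro prod.cong refl)
    fix j assume "j \<in> ?J"
    then have "fps_of_poly (?L j ^ 3) $ 0 \<noteq> 0"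
      using dne by (simp add: poly_0_coeff_0[symmetric])
    then show "?f j * fps_of_poly (?L j ^ 3) = fps_of_poly (?Q j)"
      by (simp add: mult.assoc inverse_mult_eq_1)
  qed
  define H where "H = fps_of_poly B * inverse (fps_of_poly D)"
  have "fps_of_poly A + fps_X ^ 3 * H = fps_const W * (fps_of_poly (?Q i) * g)"
  proof -
    have "(fps_of_poly A + fps_X ^ 3 * H) * fps_of_poly D
        = fps_of_poly A * fps_of_poly D + fps_X ^ 3 * fps_of_poly B"
      using D0 by (simp add: H_def distrib_right mult.assoc inverse_mult_eq_1)
    also have "\<dots> = fps_of_poly (A * D + [:0, 1:] ^ 3 * B)"
      by (simp add: fps_of_poly_add fps_of_poly_mult fps_of_poly_power)
    also have "\<dots> = fps_const W * (fps_of_poly (?Q i) * g) * fps_of_poly D"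
      unfolding poly_id by (simp add: fps_of_poly_smult fps_of_poly_mult gD mult.assoc)
    finally show ?thesis
      using D0 by auto
  qed
  then have c: "(fps_of_poly A + fps_X ^ 3 * H) $ k = (fps_const W * (fps_of_poly (?Q i) * g)) $ k" for k
    by simp
  \<comment> \<open>Since \<open>d i = 0\<close>, this factor is
    \<open>u\<^sup>2 + \<theta> i\<close>. Its leading 1 contributes the extra \<open>P\<close> in
    \<open>C i 0\<close>, which is the \<open>2 / \<theta> i\<close> term of
    \<open>hypoxg_A3\<close>. In \<open>A\<close> the order is reversed: the constant coefficient
    belongs to the pole of order three.\<close>
  have Qi: "fps_of_poly (?Q i) $ 0 = \<theta> i" "fps_of_poly (?Q i) $ 1 = 0" "fps_of_poly (?Q i) $ 2 = 1"
    by (simp_all add: d_def eval_nat_numeral)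
  have A: "fps_of_poly A $ 0 = C i 2" "fps_of_poly A $ 1 = C i 1" "fps_of_poly A $ 2 = C i 0"
    by (simp_all add: A_def eval_nat_numeral)
  show "C i 2 = W * (\<theta> i * P)"
    using c[of 0] A Qi g by (simp add: fps_X_power_mult_nth)
  show "C i 1 = W * (\<theta> i * P * r)"
    using c[of 1] unfolding fps_add_nth fps_mult_left_const_nth fps_mult_nth_1 A Qi g
    by (simp add: fps_X_power_mult_nth)
  show "C i 0 = W * (P + \<theta> i * P * (r\<^sup>2 + w) / 2)"
    using c[of 2] unfolding fps_add_nth fps_mult_left_const_nth fps_mult_nth_2 A Qi g
    by (simp add: fps_X_power_mult_nth algebra_simps)
qed

section \<open>Reliability and hazard of the Erlang variables and of the sum\<close>

lemma (in prob_space) reliability_eq_integral: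
  assumes "distributed M lborel X (\<lambda>t. ennreal (f t))" "\<And>t. 0 \<le> f t"
  shows "reliability M X t = (\<integral>x. f x * indicator {t<..} x \<partial>lborel)"
proof -
  have X [measurable]: "X \<in> borel_measurable M"
    using distributed_measurable[OF assms(1)] by simp
  interpret D: prob_space "distr M borel X"
    by (rule prob_space_distr) simp
  have "reliability M X t = 1 - measure (distr M borel X) {..t}"
    by (simp add: reliability_def cdf_def)
  also have "\<dots> = measure (distr M borel X) {t<..}"
    using D.prob_compl[of "{..t}"] by (simp add: Compl_eq_Diff_UNIV[symmetric])
  also have "\<dots> = measure M (X -` {t<..} \<inter> space M)"
    by (simp add: measure_distr)
  also have "\<dots> = (\<integral>\<omega>. indicator {t<..} (X \<omega>) \<partial>M)"
    by (simp add: integral_indicator indicator_vimage[symmetric] flip: vimage_def)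
  also have "\<dots> = (\<integral>x. f x * indicator {t<..} x \<partial>lborel)"
    using assms by (intro distributed_integral[symmetric]) auto
  finally show ?thesis .
qed

lemma integrable_pexp_tail:
  assumes "0 < a" "0 \<le> t"
  shows "integrable lborel (\<lambda>x. pexp a k x * indicator {t<..} x)"
proof -
  have "integrable lborel (\<lambda>x. (if 0 < x then pexp a k x else 0) * exp (- 0 * x))"
    using has_bochner_integral_pexp_laplace[of a 0 k] assms by (auto simp: has_bochner_integral_iff)
  from integrable_real_mult_indicator[OF _ this, of "{t<..}"]
  have "integrable lborel (\<lambda>x. (if 0 < x then pexp a k x else 0) * exp (- 0 * x) * indicator {t<..} x)"
    by simp
  then show ?thesis
    by (rule Bochner_Integration.integrable_cong[THEN iffD1, rotated -1])
      (use assms in \<open>auto simp: indicator_def\<close>)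
qed

text \<open>Left as an integral: the same tails occur in the reliability of the sum and in those of
  the Erlang variables, so they are matched without being evaluated.\<close>

definition pexp_tail :: "real \<Rightarrow> nat \<Rightarrow> real \<Rightarrow> real" where
  "pexp_tail a k t = (\<integral>x. pexp a k x * indicator {t<..} x \<partial>lborel)"

lemma Erl_reliability:
  assumes "prob_space N" "Erl N Y (Suc k) a" "0 < a" "0 < t"
  shows "reliability N Y t = a ^ Suc k * pexp_tail a k t"
proof -
  interpret prob_space N by fact
  have "reliability N Y t = (\<integral>x. erlang_density k a x * indicator {t<..} x \<partial>lborel)"
    using assms by (intro reliability_eq_integral) (auto simp: Erl_def)
  also have "\<dots> = (\<integral>x. a ^ Suc k * (pexp a k x * indicator {t<..} x) \<partial>lborel)"
    using assms
    by (intro Bochner_Integration.integral_cong) (auto simp: indicator_def erlang_density_eq_pexp)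
  finally show ?thesis
    by (simp add: pexp_tail_def)
qed

text \<open>Allows the reliability to be cancelled in
  \<open>hazard N Y t * reliability N Y t\<close>. The closed form of the Erlang distribution
  function shows it as a finite sum of positive terms.\<close>

lemma Erl_reliability_pos:
  assumes "prob_space N" "Erl N Y (Suc k) a" "0 < a" "0 < t"
  shows "0 < reliability N Y t"
proof -
  interpret prob_space N by fact
  have D: "distributed N lborel Y (\<lambda>x. ennreal (erlang_density k a x))"
    using assms(2) by (simp add: Erl_def)
  have Y [measurable]: "Y \<in> borel_measurable N"
    using distributed_measurable[OF D] by simp
  have "cdf (distr N borel Y) t = \<P>(x in N. Y x \<le> t)"
    by (simp add: cdf_def measure_distr vimage_def Int_def conj_commute)
  also have "\<dots> = erlang_CDF k a t"
    using assms D by (intro erlang_distributed_le) auto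
  finally have "reliability N Y t = (\<Sum>n\<le>k. (a * t) ^ n * exp (- a * t) / fact n)"
    using assms by (simp add: reliability_def erlang_CDF_def)
  also have "\<dots> > 0"
    using assms by (intro sum_pos) auto
  finally show ?thesis .
qed

lemma Erl_hazard_mult_reliability:
  assumes "prob_space N" "Erl N Y (Suc k) a" "0 < a" "0 < t"
  shows "hazard N Y t * reliability N Y t = a ^ Suc k * pexp a k t"
proof -
  have "continuous_on {0<..} (\<lambda>t. a ^ Suc k * pexp a k t)"
    by (intro continuous_intros)
  then have "continuous_on {0<..} (erlang_density k a)"
    by (rule continuous_on_eq) (simp add: erlang_density_eq_pexp)
  then have "is_cont_density N Y (erlang_density k a)"
    using assms by (simp add: is_cont_density_def Erl_def)
  then have "cont_density N Y t = a ^ Suc k * pexp a k t"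
    using cont_density_eq[OF assms(1)] \<open>0 < t\<close> by (simp add: erlang_density_eq_pexp)
  then show ?thesis
    using Erl_reliability_pos[OF assms] by (simp add: hazard_def)
qed

text \<open>The sum of the \<open>R i k\<close> never enters: reliabilities are integrals of the densities over
  \<open>(t, \<infinity>)\<close>, hence linear in them.\<close>

lemma HypoXG_density_reliability:
  assumes "n \<ge> 1" "\<forall>i\<in>{1..n}. 0 < \<theta> i" "inj_on \<theta> {1..n}" "prob_space M" "HypoXG M S n \<theta>" "0 < t"
  shows "cont_density M S t
      = (\<Sum>i=1..n. \<Sum>k=1..3. hypoxg_R n \<theta> i k * (\<theta> i ^ (4 - k) * pexp (\<theta> i) (3 - k) t))"
    and "reliability M S t
      = (\<Sum>i=1..n. \<Sum>k=1..3. hypoxg_R n \<theta> i k * (\<theta> i ^ (4 - k) * pexp_tail (\<theta> i) (3 - k) t))"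
proof -
  interpret prob_space M by fact
  let ?I = "{1..n}"
  obtain X where X: "indep_vars (\<lambda>_. borel) X ?I" "\<And>j. j \<in> ?I \<Longrightarrow> XG M (X j) (\<theta> j)"
    "\<And>\<omega>. \<omega> \<in> space M \<Longrightarrow> S \<omega> = (\<Sum>j\<in>?I. X j \<omega>)"
    using assms(5) unfolding HypoXG_def by blast
  have pos: "0 < \<theta> j" if "j \<in> ?I" for j
    using assms(2) that by blast
  obtain f where f: "exp_comb ?I \<theta> f" "\<And>t. 0 < t \<Longrightarrow> 0 \<le> f t"
    "distributed M lborel (\<lambda>\<omega>. \<Sum>j\<in>?I. X j \<omega>) (\<lambda>t. ennreal (if 0 < t then f t else 0))"
    using distributed_sum_XG[OF _ _ X(1) assms(3) pos X(2)] assms(1) by auto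
  obtain C where C: "\<And>t. f t = (\<Sum>i\<in>?I. \<Sum>k<3. C i k * pexp (\<theta> i) k t)"
    using f(1) unfolding exp_comb_def by blast
  \<comment> \<open>The exponential polynomial \<open>f\<close> need not vanish for
    \<open>t \<le> 0\<close>, so the density is its cut-off.\<close>
  define g where "g t = (if 0 < t then f t else 0)" for t
  have g0: "0 \<le> g t" for t
    using f(2) by (simp add: g_def)
  have dX: "distributed M lborel (\<lambda>\<omega>. \<Sum>j\<in>?I. X j \<omega>) (\<lambda>t. ennreal (g t))"
    using f(3) by (simp add: g_def)
  \<comment> \<open>\<open>S\<close> agrees with the sum only on \<open>space M\<close>, so
    measurability and distribution are transferred by congruence.\<close>
  have meas: "S \<in> borel_measurable M \<longleftrightarrow> (\<lambda>\<omega>. \<Sum>j\<in>?I. X j \<omega>) \<in> borel_measurable M"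
    using X(3) by (intro measurable_cong) auto
  have "distr M lborel S = distr M lborel (\<lambda>\<omega>. \<Sum>j\<in>?I. X j \<omega>)"
    using X(3) by (intro distr_cong) auto
  then have dS: "distributed M lborel S (\<lambda>t. ennreal (g t))"
    using dX meas by (simp add: distributed_def)
  let ?W = "\<Prod>j\<in>?I. (\<theta> j)\<^sup>2 / (1 + \<theta> j)"
  \<comment> \<open>The transform of the sum is evaluated twice, termwise from the density and
    through independence.\<close>
  have lap: "(\<Sum>j\<in>?I. \<Sum>k<3. C j k / (s + \<theta> j) ^ Suc k)
      = ?W * (\<Prod>j\<in>?I. ((s + \<theta> j)\<^sup>2 + \<theta> j) / (s + \<theta> j) ^ 3)" if "0 \<le> s" for s
  proof -
    have "has_bochner_integral lborel
        (\<lambda>t. \<Sum>i\<in>?I. \<Sum>k<3. C i k * ((if 0 < t then pexp (\<theta> i) k t else 0) * exp (- s * t)))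
        (\<Sum>i\<in>?I. \<Sum>k<3. C i k * (1 / (\<theta> i + s) ^ Suc k))"
      using that pos
      by (intro has_bochner_integral_sum has_bochner_integral_mult_right
          has_bochner_integral_pexp_laplace) (auto intro: add_pos_nonneg)
    moreover have "(\<lambda>t. \<Sum>i\<in>?I. \<Sum>k<3. C i k * ((if 0 < t then pexp (\<theta> i) k t else 0) * exp (- s * t)))
        = (\<lambda>t. g t * exp (- s * t))"
      by (auto simp: g_def C sum_distrib_right mult.assoc)
    ultimately have "(\<integral>t. g t * exp (- s * t) \<partial>lborel) = (\<Sum>i\<in>?I. \<Sum>k<3. C i k / (s + \<theta> i) ^ Suc k)"
      by (simp add: has_bochner_integral_iff add.commute)
    moreover have "(\<integral>t. g t * exp (- s * t) \<partial>lborel) = (\<integral>\<omega>. exp (- s * (\<Sum>j\<in>?I. X j \<omega>)) \<partial>M)"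
      using g0 by (intro distributed_integral[OF dX]) auto
    ultimately show ?thesis
      using laplace_sum_XG[OF _ X(1) pos X(2) that] by simp
  qed
  \<comment> \<open>Coefficient \<open>k\<close> belongs to the Erlang law with \<open>4 - k\<close>
    stages, that is to a pole of order \<open>4 - k\<close> and to \<open>pexp\<close> index
    \<open>3 - k\<close>. The power of \<open>\<theta> i\<close> from the Erlang density cancels the
    denominator in \<open>hypoxg_R\<close>.\<close>
  have R: "hypoxg_R n \<theta> i k * \<theta> i ^ (4 - k) = C i (3 - k)" if i: "i \<in> ?I" and k: "k \<in> {1..3}" for i k
  proof -
    note c = partial_fraction_coefficients[OF finite_atLeastAtMost i assms(3) pos lap]
    have "hypoxg_R n \<theta> i k * \<theta> i ^ (4 - k) = ?W * hypoxg_A n \<theta> i k"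
      using pos[OF i] by (simp add: hypoxg_R_def)
    moreover have "k = 1 \<or> k = 2 \<or> k = 3"
      using k by auto
    ultimately show ?thesis
      using c pos[OF i]
      by (auto simp: hypoxg_A_def hypoxg_A1_def hypoxg_A2_def hypoxg_A3_def field_simps)
  qed
  have reindex: "(\<Sum>k<3. C i k * h k) = (\<Sum>k=1..3. hypoxg_R n \<theta> i k * (\<theta> i ^ (4 - k) * h (3 - k)))"
    if "i \<in> ?I" for i and h :: "nat \<Rightarrow> real"
  proof -
    have "(\<Sum>k=1..3. hypoxg_R n \<theta> i k * (\<theta> i ^ (4 - k) * h (3 - k)))
        = (\<Sum>k=1..3. C i (3 - k) * h (3 - k))"
      by (intro sum.cong refl) (simp only: mult.assoc[symmetric] R[OF that])
    also have "\<dots> = (\<Sum>k<3. C i k * h k)"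
      by (intro sum.reindex_bij_witness[of _ "\<lambda>k. 3 - k" "\<lambda>k. 3 - k"]) auto
    finally show ?thesis ..
  qed
  have "continuous_on {0<..} f"
    unfolding C by (intro continuous_intros)
  then have "continuous_on {0<..} g"
    by (rule continuous_on_eq) (simp add: g_def)
  then have "cont_density M S t = g t"
    using dS g0 assms(6) by (intro cont_density_eq[OF assms(4)]) (auto simp: is_cont_density_def)
  then show "cont_density M S t
      = (\<Sum>i=1..n. \<Sum>k=1..3. hypoxg_R n \<theta> i k * (\<theta> i ^ (4 - k) * pexp (\<theta> i) (3 - k) t))"
    using assms(6) by (simp add: g_def C reindex)
  have "reliability M S t = (\<integral>x. g x * indicator {t<..} x \<partial>lborel)"
    using dS g0 by (rule reliability_eq_integral)
  also have "\<dots> = (\<integral>x. (\<Sum>i\<in>?I. \<Sum>k<3. C i k * (pexp (\<theta> i) k x * indicator {t<..} x)) \<partial>lborel)"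
    using assms(6)
    by (intro Bochner_Integration.integral_cong) (auto simp: g_def C indicator_def)
  also have "\<dots> = (\<Sum>i\<in>?I. \<Sum>k<3. C i k * pexp_tail (\<theta> i) k t)"
    using assms(6) pos
    by (simp add: pexp_tail_def integrable_pexp_tail)
  finally show "reliability M S t
      = (\<Sum>i=1..n. \<Sum>k=1..3. hypoxg_R n \<theta> i k * (\<theta> i ^ (4 - k) * pexp_tail (\<theta> i) (3 - k) t))"
    by (simp add: reindex)
qed

theorem theorem2p6:
  fixes M :: "'a measure" and S :: "'a \<Rightarrow> real"
    and N :: "nat \<Rightarrow> nat \<Rightarrow> 'b measure" and Y :: "nat \<Rightarrow> nat \<Rightarrow> 'b \<Rightarrow> real"
    and n :: nat and \<theta> :: "nat \<Rightarrow> real" and t :: real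
  assumes "n \<ge> 1"
    and "\<forall>i\<in>{1..n}. \<theta> i > 0"
    and "inj_on \<theta> {1..n}"
    and "prob_space M"
    and "HypoXG M S n \<theta>"
    and "\<forall>i\<in>{1..n}. \<forall>k\<in>{1..3}. prob_space (N i k) \<and> Erl (N i k) (Y i k) (4 - k) (\<theta> i)"
    and "t > 0"
  shows "hazard M S t =
    (\<Sum>i=1..n. \<Sum>k=1..3. hypoxg_R n \<theta> i k * hazard (N i k) (Y i k) t * reliability (N i k) (Y i k) t) /
    (\<Sum>i=1..n. \<Sum>k=1..3. hypoxg_R n \<theta> i k * reliability (N i k) (Y i k) t)"
proof -
  \<comment> \<open>For \<open>k\<close> between 1 and 3 the stage count \<open>4 - k\<close> is a
    successor, the form in which the Erlang lemmas are stated.\<close>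
  have Y: "prob_space (N i k)" "Erl (N i k) (Y i k) (Suc (3 - k)) (\<theta> i)" "0 < \<theta> i" "4 - k = Suc (3 - k)"
    if "i \<in> {1..n}" "k \<in> {1..3}" for i k
    using assms(2,6) that by (auto simp: Suc_diff_le[symmetric])
  have "cont_density M S t
      = (\<Sum>i=1..n. \<Sum>k=1..3. hypoxg_R n \<theta> i k * hazard (N i k) (Y i k) t * reliability (N i k) (Y i k) t)"
    unfolding HypoXG_density_reliability(1)[OF assms(1-5,7)] mult.assoc
    by (intro sum.cong refl) (simp only: Erl_hazard_mult_reliability[OF Y(1-3) \<open>t > 0\<close>] Y(4))
  moreover have "reliability M S t
      = (\<Sum>i=1..n. \<Sum>k=1..3. hypoxg_R n \<theta> i k * reliability (N i k) (Y i k) t)"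
    unfolding HypoXG_density_reliability(2)[OF assms(1-5,7)]
    by (intro sum.cong refl) (simp only: Erl_reliability[OF Y(1-3) \<open>t > 0\<close>] Y(4))
  ultimately show ?thesis
    by (simp add: hazard_def)
qed

end
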